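(* Consider the scheme defined in the context for a conservation law $\partial_t u+\nabla\cdot\bm f(u)=0$. Let $\hat{\bm 1}\in\mathbb{R}^{1\times N_p}$ be the coefficient vector of the constant function $1$, i.e. $\chi(\xi_v)\hat{\bm 1}^T=(1,\dots,1)^T$. Then the scheme is locally conservative: on every element $m$, $$\hat{\bm 1}\,(M_m+K_m)\frac{d}{dt}\hat{\bm u}_m(t)^T=-\sum_{f=1}^{N_f}\sum_{k=1}^{N_{fp}}W_{f,k}\,\Big[\big(\hat{\bm n}^rC_m(\xi_{f,k})^T\big)\cdot\bm f_m^*\Big].$$ It is also globally conservative: with periodic boundary conditions, $$\sum_m\hat{\bm 1}\,(M_m+K_m)\frac{d}{dt}\hat{\bm u}_m(t)^T=0 .$$
   Context: Reference element and basis: $\Omega_r=[-1,1]^3$ with coordinates $\xi=(\xi_1,\xi_2,\xi_3)$, $p\ge1$, $N_p=(p+1)^3$, and $\chi(\xi)=[\chi_1(\xi),\dots,\chi_{N_p}(\xi)]$ (row vector) a basis of the tensor-product polynomials of degree at most $p$ in each variable. The domain is partitioned into finitely many elements $\Omega_m$, each the image of $\Omega_r$ under a time-independent, possibly non-affine, mapping $\Theta_m$ with $J_m=\det(\partial x/\partial\xi)>0$. The solution in element $m$ is $u_m=\chi\hat{\bm u}_m(t)^T$ with $\hat{\bm u}_m\in\mathbb{R}^{1\times N_p}$. Quadrature: volume nodes $\xi_{v,q}$, $q=1,\dots,N_{vp}$, with diagonal weight matrix $W$; facet nodes $\xi_{f,k}$ with weights $W_{f,k}>0$ on the faces $f=1,\dots,N_f$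 of $\Omega_r$; $\hat{\bm n}^r$ is the outward reference unit normal (row vector). The quadrature is exact to degree at least $2p-1$ and satisfies discrete integration by parts: with $\chi(\xi_v)$, $\chi_{\xi_j}(\xi_v)$ the $N_{vp}\times N_p$ matrices of basis values and $\xi_j$-derivatives, and $S_j=\chi(\xi_v)^TW\chi_{\xi_j}(\xi_v)$, $S_j+S_j^T=\sum_{f,k}\chi(\xi_{f,k})^TW_{f,k}\hat n^r_j\chi(\xi_{f,k})$. $M=\chi(\xi_v)^TW\chi(\xi_v)$ is invertible and $\Pi=M^{-1}\chi(\xi_v)^TW$ is the discrete $L_2$ projection. Metric terms: $C_m(\xi)\in\mathbb{R}^{3\times3}$ is the discrete metric cofactor matrix computed in conservative curl form, $(C_m)_{ni}=-\hat e_i\cdot\nabla^r\times\mathcal I[x_l\nabla^r x_k]$ with $(n,k,l)$ cyclic, where $x_1,x_2,x_3$ are the components of the polynomial mapping and $\mathcal I$ is polynomial interpolation at the mapping (grid) nodes (or in the analogous invariant curl form, with $\tfrac12(x_l\nabla^rx_k-x_k\nabla^rx_l)$ in place of $x_l\nabla^r x_k$). Hence its entries are polynomials with $\sum_{i}\partial_{\xi_i}(C_m)_{ni}=0$ for $n=1,2,3$ (geometric conservation law), and they are reproduced by the projection: $\chi(\xi)\Pi[(C_m)_{ni}(\xi_{v,q})]_q=(C_m)_{ni}(\xi)$. Norm: $M_m=\chi(\xi_v)^TWJ_m\chi(\xi_v)$, with $J_m$ the diagonal matrix of Jacobian determinants at volume nodes, and $$K_m=\sum_{(s,v,w)}c_{(s,v,w)}\,\partial^{(s,v,w)}\chi(\xi_v)^T\,WJ_m\,\partial^{(s,v,w)}\chi(\xi_v),$$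 the sum over $s,v,w\in\{0,p\}$ with $s+v+w\ge p$, where $\partial^{(s,v,w)}=\partial^{s+v+w}/\partial\xi_1^s\partial\xi_2^v\partial\xi_3^w$ and $c_{(s,v,w)}=c_{1D}^{(s+v+w)/p}$. The parameter $c_{1D}$ is such that $M_m+K_m$ is symmetric positive definite. Fluxes: $\hat{\bm f}_{m,i}^T=\Pi\,[f_i(u_m(\xi_{v,q}))]_q$ are the coefficients of the $i$th physical flux component, and $\hat{\bm f}^{r\,T}_{m,j}=\Pi\,[\sum_i f_i(u_m(\xi_{v,q}))(C_m(\xi_{v,q}))_{ij}]_q$ those of the $j$th reference flux component. Write $\nabla^r\chi(\xi_v)\cdot\hat{\bm f}_m^{r\,T}=\sum_j\chi_{\xi_j}(\xi_v)\hat{\bm f}^{r\,T}_{m,j}$ and $\tilde\nabla^r\chi(\xi_v)\cdot\hat{\bm f}_m^T=\sum_{i,j}\mathrm{diag}_q\big((C_m(\xi_{v,q}))_{ij}\big)\chi_{\xi_j}(\xi_v)\hat{\bm f}_{m,i}^T$. At a facet node, $\bm f_m=\chi(\xi_{f,k})\hat{\bm f}_m^T$ is the (projected) physical flux, $\bm f_m^*$ is the numerical flux, and $\bm f_m^{C,r}=\bm f_m^*C_m(\xi_{f,k})-\tfrac12\bm f_mC_m(\xi_{f,k})-\tfrac12\chi(\xi_{f,k})\hat{\bm f}_m^{r\,T}$. Scheme: for every element $m$, $$(M_m+K_m)\frac{d\hat{\bm u}_m^T}{dt}+\tfrac12\chi(\xi_v)^TW\big[\nabla^r\chi(\xi_v)\cdot\hat{\bm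 f}_m^{r\,T}+\tilde\nabla^r\chi(\xi_v)\cdot\hat{\bm f}_m^T\big]+\sum_{f,k}\chi(\xi_{f,k})^TW_{f,k}\,[\hat{\bm n}^r\cdot\bm f_m^{C,r}]=\bm0^T .$$ Mesh: conforming and water-tight, and periodic for the global statement. At each facet node shared by two elements the node positions and weights coincide, the numerical flux $\bm f^*$ is single valued, and the vectors $\hat{\bm n}^rC_m^T$ from the two sides are negatives of each other. *)

theory Defs
  imports "HOL-Analysis.Analysis"
begin

text \<open>
  Arithmetic on the index type \<open>3\<close> is modulo 3, so \<open>(n, n + 1, n + 2)\<close> runs through the cyclic
  triples. Row vectors and their transposes are both rendered as \<open>real ^ 'n\<close>; \<open>v v* A\<close> is the
  product of the row vector \<open>v\<close> with \<open>A\<close>.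
\<close>

definition ref_cube :: "(real^3) set" where
  "ref_cube = {\<xi>. \<forall>i. -1 \<le> \<xi> $ i \<and> \<xi> $ i \<le> 1}"

text \<open>\<open>(i, True)\<close> is the face \<open>\<xi>\<^sub>i = 1\<close> and \<open>(i, False)\<close> the face \<open>\<xi>\<^sub>i = -1\<close>.\<close>

type_synonym face = "3 \<times> bool"

definition ref_normal :: "face \<Rightarrow> real^3" where
  "ref_normal F = (if snd F then axis (fst F) 1 else - axis (fst F) 1)"

definition ref_face :: "face \<Rightarrow> (real^3) set" where
  "ref_face F = {\<xi> \<in> ref_cube. \<xi> $ fst F = (if snd F then 1 else -1)}"

definition tensor_poly :: "nat \<Rightarrow> (real^3 \<Rightarrow> real) set" where
  "tensor_poly d = {g. \<exists>a :: nat \<Rightarrow> nat \<Rightarrow> nat \<Rightarrow> real.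
     g = (\<lambda>\<xi>. \<Sum>i\<le>d. \<Sum>j\<le>d. \<Sum>k\<le>d. a i j k * (\<xi>$1)^i * (\<xi>$2)^j * (\<xi>$3)^k)}"

definition tensor_basis :: "nat \<Rightarrow> (real^3 \<Rightarrow> real^'b) \<Rightarrow> bool" where
  "tensor_basis p chi \<longleftrightarrow>
     CARD('b) = (p + 1)^3 \<and>
     (\<forall>b. (\<lambda>\<xi>. chi \<xi> $ b) \<in> tensor_poly p) \<and>
     (\<forall>g \<in> tensor_poly p. \<exists>!c. g = (\<lambda>\<xi>. chi \<xi> \<bullet> c))"

definition partial_deriv :: "3 \<Rightarrow> (real^3 \<Rightarrow> real) \<Rightarrow> real^3 \<Rightarrow> real" where
  "partial_deriv j g \<xi> = deriv (\<lambda>h. g (\<xi> + h *\<^sub>R axis j 1)) 0"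

definition mixed_deriv :: "nat \<Rightarrow> nat \<Rightarrow> nat \<Rightarrow> (real^3 \<Rightarrow> real) \<Rightarrow> real^3 \<Rightarrow> real" where
  "mixed_deriv s v w g =
     (partial_deriv 1 ^^ s) ((partial_deriv 2 ^^ v) ((partial_deriv 3 ^^ w) g))"

definition gradient :: "(real^3 \<Rightarrow> real) \<Rightarrow> real^3 \<Rightarrow> real^3" where
  "gradient g \<xi> = (\<chi> j. partial_deriv j g \<xi>)"

definition curl :: "(real^3 \<Rightarrow> real^3) \<Rightarrow> real^3 \<Rightarrow> real^3" where
  "curl G \<xi> = (\<chi> i. partial_deriv (i + 1) (\<lambda>\<eta>. G \<eta> $ (i + 2)) \<xi>
                    - partial_deriv (i + 2) (\<lambda>\<eta>. G \<eta> $ (i + 1)) \<xi>)"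

definition unisolvent :: "nat \<Rightarrow> ('g \<Rightarrow> real^3) \<Rightarrow> bool" where
  "unisolvent r z \<longleftrightarrow> (\<forall>h :: 'g \<Rightarrow> real. \<exists>!g. g \<in> tensor_poly r \<and> (\<forall>a. g (z a) = h a))"

definition interpolant :: "nat \<Rightarrow> ('g \<Rightarrow> real^3) \<Rightarrow> (real^3 \<Rightarrow> real) \<Rightarrow> real^3 \<Rightarrow> real" where
  "interpolant r z h = (THE g. g \<in> tensor_poly r \<and> (\<forall>a. g (z a) = h (z a)))"

definition vec_interpolant ::
    "nat \<Rightarrow> ('g \<Rightarrow> real^3) \<Rightarrow> (real^3 \<Rightarrow> real^3) \<Rightarrow> real^3 \<Rightarrow> real^3" where
  "vec_interpolant r z G \<xi> = (\<chi> j. interpolant r z (\<lambda>\<eta>. G \<eta> $ j) \<xi>)"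

datatype curl_form = Conservative | Invariant

text \<open>The field \<open>x\<^sub>l \<nabla>x\<^sub>k\<close>, or its antisymmetrised version, for the cyclic triple \<open>(n, k, l)\<close>.\<close>

definition curl_potential :: "curl_form \<Rightarrow> (real^3 \<Rightarrow> real^3) \<Rightarrow> 3 \<Rightarrow> real^3 \<Rightarrow> real^3" where
  "curl_potential form \<Theta> n \<xi> =
     (let k = n + 1; l = n + 2; x = (\<lambda>i \<eta>. \<Theta> \<eta> $ i) in
      case form of
        Conservative \<Rightarrow> x l \<xi> *\<^sub>R gradient (x k) \<xi>
      | Invariant \<Rightarrow> (1/2) *\<^sub>R (x l \<xi> *\<^sub>R gradient (x k) \<xi> - x k \<xi> *\<^sub>R gradient (x l) \<xi>))"

definition metric_cofactor ::
    "curl_form \<Rightarrow> nat \<Rightarrow> ('g \<Rightarrow> real^3) \<Rightarrow> (real^3 \<Rightarrow> real^3) \<Rightarrow> real^3 \<Rightarrow> real^3^3" where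
  "metric_cofactor form r z \<Theta> \<xi> =
     (\<chi> n i. - (curl (vec_interpolant r z (curl_potential form \<Theta> n)) \<xi> $ i))"

definition diag_matrix :: "real^'q \<Rightarrow> real^'q^'q" where
  "diag_matrix w = (\<chi> i j. if i = j then w $ i else 0)"

definition basis_matrix :: "(real^3 \<Rightarrow> real^'b) \<Rightarrow> ('q \<Rightarrow> real^3) \<Rightarrow> real^'b^'q" where
  "basis_matrix chi xv = (\<chi> q. chi (xv q))"

definition deriv_matrix ::
    "nat \<Rightarrow> nat \<Rightarrow> nat \<Rightarrow> (real^3 \<Rightarrow> real^'b) \<Rightarrow> ('q \<Rightarrow> real^3) \<Rightarrow> real^'b^'q" where
  "deriv_matrix s v w chi xv = (\<chi> q b. mixed_deriv s v w (\<lambda>\<xi>. chi \<xi> $ b) (xv q))"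

definition pderiv_matrix ::
    "3 \<Rightarrow> (real^3 \<Rightarrow> real^'b) \<Rightarrow> ('q \<Rightarrow> real^3) \<Rightarrow> real^'b^'q" where
  "pderiv_matrix j chi xv = (\<chi> q b. partial_deriv j (\<lambda>\<xi>. chi \<xi> $ b) (xv q))"

definition volume_exact :: "nat \<Rightarrow> ('q::finite \<Rightarrow> real^3) \<Rightarrow> real^'q \<Rightarrow> bool" where
  "volume_exact d xv w \<longleftrightarrow>
     (\<forall>g \<in> tensor_poly d. (\<Sum>q\<in>UNIV. w $ q * g (xv q)) = integral ref_cube g)"

definition facet_exact ::
    "nat \<Rightarrow> (face \<Rightarrow> 'k::finite \<Rightarrow> real^3) \<Rightarrow> (face \<Rightarrow> 'k \<Rightarrow> real) \<Rightarrow> bool" where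
  "facet_exact d xf fw \<longleftrightarrow>
     (\<forall>F. \<forall>g \<in> tensor_poly d. (\<Sum>k\<in>UNIV. fw F k * g (xf F k)) =
        integral {-1..1} (\<lambda>a. integral {-1..1} (\<lambda>b.
          g (ref_normal F + a *\<^sub>R axis (fst F + 1) 1 + b *\<^sub>R axis (fst F + 2) 1))))"

definition mass_matrix ::
    "(real^3 \<Rightarrow> real^'b) \<Rightarrow> ('q::finite \<Rightarrow> real^3) \<Rightarrow> real^'q \<Rightarrow> real^'b^'b" where
  "mass_matrix chi xv w =
     transpose (basis_matrix chi xv) ** diag_matrix w ** basis_matrix chi xv"

definition L2_projection ::
    "(real^3 \<Rightarrow> real^'b) \<Rightarrow> ('q::finite \<Rightarrow> real^3) \<Rightarrow> real^'q \<Rightarrow> real^'q^'b" where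
  "L2_projection chi xv w =
     matrix_inv (mass_matrix chi xv w) ** transpose (basis_matrix chi xv) ** diag_matrix w"

definition stiffness_matrix ::
    "3 \<Rightarrow> (real^3 \<Rightarrow> real^'b) \<Rightarrow> ('q::finite \<Rightarrow> real^3) \<Rightarrow> real^'q \<Rightarrow> real^'b^'b" where
  "stiffness_matrix j chi xv w =
     transpose (basis_matrix chi xv) ** diag_matrix w ** pderiv_matrix j chi xv"

definition discrete_ibp ::
    "(real^3 \<Rightarrow> real^'b) \<Rightarrow> ('q::finite \<Rightarrow> real^3) \<Rightarrow> real^'q \<Rightarrow>
     (face \<Rightarrow> 'k::finite \<Rightarrow> real^3) \<Rightarrow> (face \<Rightarrow> 'k \<Rightarrow> real) \<Rightarrow> bool" where
  "discrete_ibp chi xv w xf fw \<longleftrightarrow>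
     (\<forall>j. stiffness_matrix j chi xv w + transpose (stiffness_matrix j chi xv w) =
        (\<Sum>F\<in>UNIV. \<Sum>k\<in>UNIV.
           (\<chi> a b. chi (xf F k) $ a * fw F k * ref_normal F $ j * chi (xf F k) $ b)))"

definition sym_pos_def :: "real^'b^'b \<Rightarrow> bool" where
  "sym_pos_def A \<longleftrightarrow> transpose A = A \<and> (\<forall>x. x \<noteq> 0 \<longrightarrow> 0 < x \<bullet> (A *v x))"

definition jacobian_diag ::
    "(real^3 \<Rightarrow> real^3) \<Rightarrow> ('q \<Rightarrow> real^3) \<Rightarrow> real^'q^'q" where
  "jacobian_diag \<Theta> xv = diag_matrix (\<chi> q. det (jacobian \<Theta> (at (xv q))))"

definition elem_mass ::
    "(real^3 \<Rightarrow> real^'b) \<Rightarrow> ('q::finite \<Rightarrow> real^3) \<Rightarrow> real^'q \<Rightarrow> (real^3 \<Rightarrow> real^3) \<Rightarrow> real^'b^'b" where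
  "elem_mass chi xv w \<Theta> =
     transpose (basis_matrix chi xv) ** diag_matrix w ** jacobian_diag \<Theta> xv ** basis_matrix chi xv"

text \<open>In the sum below \<open>s + v + w\<close> is a multiple of \<open>p\<close>, so the integer division is exact.\<close>

definition elem_corr ::
    "nat \<Rightarrow> real \<Rightarrow> (real^3 \<Rightarrow> real^'b) \<Rightarrow> ('q::finite \<Rightarrow> real^3) \<Rightarrow> real^'q \<Rightarrow>
     (real^3 \<Rightarrow> real^3) \<Rightarrow> real^'b^'b" where
  "elem_corr p c chi xv w \<Theta> =
     (\<Sum>(s, v, r) \<in> {(s, v, r). s \<in> {0, p} \<and> v \<in> {0, p} \<and> r \<in> {0, p} \<and> s + v + r \<ge> p}.
        c ^ ((s + v + r) div p) *\<^sub>R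
          (transpose (deriv_matrix s v r chi xv) ** diag_matrix w ** jacobian_diag \<Theta> xv
             ** deriv_matrix s v r chi xv))"

definition elem_norm ::
    "nat \<Rightarrow> real \<Rightarrow> (real^3 \<Rightarrow> real^'b) \<Rightarrow> ('q::finite \<Rightarrow> real^3) \<Rightarrow> real^'q \<Rightarrow>
     (real^3 \<Rightarrow> real^3) \<Rightarrow> real^'b^'b" where
  "elem_norm p c chi xv w \<Theta> = elem_mass chi xv w \<Theta> + elem_corr p c chi xv w \<Theta>"

text \<open>Throughout, \<open>f\<close> is the physical flux function, \<open>C\<close> the cofactor matrix of the element and
  \<open>u\<close> the coefficient vector of the solution in the element at one instant.\<close>

definition phys_flux_coeff ::
    "(real^3 \<Rightarrow> real^'b) \<Rightarrow> ('q::finite \<Rightarrow> real^3) \<Rightarrow> real^'q \<Rightarrow> (real \<Rightarrow> real^3) \<Rightarrow>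
     real^'b \<Rightarrow> 3 \<Rightarrow> real^'b" where
  "phys_flux_coeff chi xv w f u i =
     L2_projection chi xv w *v (\<chi> q. f (chi (xv q) \<bullet> u) $ i)"

definition ref_flux_coeff ::
    "(real^3 \<Rightarrow> real^'b) \<Rightarrow> ('q::finite \<Rightarrow> real^3) \<Rightarrow> real^'q \<Rightarrow> (real \<Rightarrow> real^3) \<Rightarrow>
     (real^3 \<Rightarrow> real^3^3) \<Rightarrow> real^'b \<Rightarrow> 3 \<Rightarrow> real^'b" where
  "ref_flux_coeff chi xv w f C u j =
     L2_projection chi xv w *v
       (\<chi> q. \<Sum>i\<in>UNIV. f (chi (xv q) \<bullet> u) $ i * C (xv q) $ i $ j)"

definition ref_flux_div ::
    "(real^3 \<Rightarrow> real^'b) \<Rightarrow> ('q::finite \<Rightarrow> real^3) \<Rightarrow> real^'q \<Rightarrow> (real \<Rightarrow> real^3) \<Rightarrow>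
     (real^3 \<Rightarrow> real^3^3) \<Rightarrow> real^'b \<Rightarrow> real^'q" where
  "ref_flux_div chi xv w f C u =
     (\<Sum>j\<in>UNIV. pderiv_matrix j chi xv *v ref_flux_coeff chi xv w f C u j)"

definition phys_flux_div ::
    "(real^3 \<Rightarrow> real^'b) \<Rightarrow> ('q::finite \<Rightarrow> real^3) \<Rightarrow> real^'q \<Rightarrow> (real \<Rightarrow> real^3) \<Rightarrow>
     (real^3 \<Rightarrow> real^3^3) \<Rightarrow> real^'b \<Rightarrow> real^'q" where
  "phys_flux_div chi xv w f C u =
     (\<Sum>i\<in>UNIV. \<Sum>j\<in>UNIV. diag_matrix (\<chi> q. C (xv q) $ i $ j) *v
        (pderiv_matrix j chi xv *v phys_flux_coeff chi xv w f u i))"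

text \<open>The correction flux at the point \<open>\<xi>\<close>, where the numerical flux takes the value \<open>fs\<close>.\<close>

definition corr_flux ::
    "(real^3 \<Rightarrow> real^'b) \<Rightarrow> ('q::finite \<Rightarrow> real^3) \<Rightarrow> real^'q \<Rightarrow> (real \<Rightarrow> real^3) \<Rightarrow>
     (real^3 \<Rightarrow> real^3^3) \<Rightarrow> real^'b \<Rightarrow> real^3 \<Rightarrow> real^3 \<Rightarrow> real^3" where
  "corr_flux chi xv w f C u \<xi> fs =
     fs v* C \<xi>
     - (1/2) *\<^sub>R ((\<chi> i. chi \<xi> \<bullet> phys_flux_coeff chi xv w f u i) v* C \<xi>)
     - (1/2) *\<^sub>R (\<chi> j. chi \<xi> \<bullet> ref_flux_coeff chi xv w f C u j)"

definition scheme_eq ::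
    "nat \<Rightarrow> real \<Rightarrow> (real^3 \<Rightarrow> real^'b) \<Rightarrow> ('q::finite \<Rightarrow> real^3) \<Rightarrow> real^'q \<Rightarrow>
     (face \<Rightarrow> 'k::finite \<Rightarrow> real^3) \<Rightarrow> (face \<Rightarrow> 'k \<Rightarrow> real) \<Rightarrow> (real \<Rightarrow> real^3) \<Rightarrow>
     (real^3 \<Rightarrow> real^3) \<Rightarrow> (real^3 \<Rightarrow> real^3^3) \<Rightarrow> (face \<Rightarrow> 'k \<Rightarrow> real^3) \<Rightarrow>
     real^'b \<Rightarrow> real^'b \<Rightarrow> bool" where
  "scheme_eq p c chi xv w xf fw f \<Theta> C fstar u du \<longleftrightarrow>
     elem_norm p c chi xv w \<Theta> *v du
     + (1/2) *\<^sub>R ((transpose (basis_matrix chi xv) ** diag_matrix w) *v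
         (ref_flux_div chi xv w f C u + phys_flux_div chi xv w f C u))
     + (\<Sum>F\<in>UNIV. \<Sum>k\<in>UNIV.
         (fw F k * (ref_normal F \<bullet> corr_flux chi xv w f C u (xf F k) (fstar F k)))
           *\<^sub>R chi (xf F k))
     = 0"

definition partition_of_domain :: "(real^3) set \<Rightarrow> ('m \<Rightarrow> real^3 \<Rightarrow> real^3) \<Rightarrow> bool" where
  "partition_of_domain \<Omega> \<Theta> \<longleftrightarrow>
     \<Omega> = (\<Union>m. \<Theta> m ` ref_cube) \<and>
     (\<forall>m m'. m \<noteq> m' \<longrightarrow> interior (\<Theta> m ` ref_cube) \<inter> interior (\<Theta> m' ` ref_cube) = {})"

text \<open>
  \<open>nbr (m, F)\<close> is the element face glued to face \<open>F\<close> of element \<open>m\<close>, if any; \<open>mate (m, F) k\<close> is the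
  index there of the facet node that meets node \<open>k\<close> of \<open>(m, F)\<close>. Faces may be glued across the domain
  by a translation \<open>shift (m, F)\<close>, which vanishes for faces inside the domain; an unglued face lies on
  the boundary of the domain.
\<close>

definition conforming_mesh ::
    "(real^3) set \<Rightarrow> (face \<Rightarrow> 'k \<Rightarrow> real^3) \<Rightarrow> (face \<Rightarrow> 'k \<Rightarrow> real) \<Rightarrow>
     ('m \<Rightarrow> real^3 \<Rightarrow> real^3) \<Rightarrow> ('m \<Rightarrow> real^3 \<Rightarrow> real^3^3) \<Rightarrow>
     ('m \<times> face \<Rightarrow> ('m \<times> face) option) \<Rightarrow> ('m \<times> face \<Rightarrow> 'k \<Rightarrow> 'k) \<Rightarrow> ('m \<times> face \<Rightarrow> real^3) \<Rightarrow> bool"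
    where
  "conforming_mesh \<Omega> xf fw \<Theta> C nbr mate shift \<longleftrightarrow>
     (\<forall>m F. nbr (m, F) = None \<longrightarrow> \<Theta> m ` ref_face F \<subseteq> frontier \<Omega>) \<and>
     (\<forall>m F m' F'. nbr (m, F) = Some (m', F') \<longrightarrow>
        (m', F') \<noteq> (m, F) \<and> nbr (m', F') = Some (m, F) \<and>
        (shift (m, F) \<noteq> 0 \<longrightarrow> \<Theta> m ` ref_face F \<subseteq> frontier \<Omega>) \<and>
        \<Theta> m ` ref_face F = (\<lambda>x. x + shift (m, F)) ` \<Theta> m' ` ref_face F' \<and>
        (\<forall>k. mate (m', F') (mate (m, F) k) = k \<and>
             \<Theta> m (xf F k) = \<Theta> m' (xf F' (mate (m, F) k)) + shift (m, F) \<and>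
             fw F k = fw F' (mate (m, F) k) \<and>
             ref_normal F v* transpose (C m (xf F k)) =
               - (ref_normal F' v* transpose (C m' (xf F' (mate (m, F) k))))))"

definition periodic_mesh :: "('m \<times> face \<Rightarrow> ('m \<times> face) option) \<Rightarrow> bool" where
  "periodic_mesh nbr \<longleftrightarrow> (\<forall>m F. nbr (m, F) \<noteq> None)"

definition single_valued_flux ::
    "('m \<times> face \<Rightarrow> ('m \<times> face) option) \<Rightarrow> ('m \<times> face \<Rightarrow> 'k \<Rightarrow> 'k) \<Rightarrow>
     ('m \<Rightarrow> face \<Rightarrow> 'k \<Rightarrow> real^3) \<Rightarrow> bool" where
  "single_valued_flux nbr mate fstar \<longleftrightarrow>
     (\<forall>m F m' F' k. nbr (m, F) = Some (m', F') \<longrightarrow>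
        fstar m F k = fstar m' F' (mate (m, F) k))"

end

theory Submission
  imports Defs
begin

text \<open>
  The rate of change of the conserved quantity in an element is obtained by testing the scheme with the
  constant function \<open>1\<close>, so the claim is a discrete divergence theorem. Discrete integration by parts
  (\<open>summation_by_parts\<close>) is used twice. Paired with the constant, the divergence of the reference flux
  leaves only a facet sum, since the constant has zero derivative. The other half of the divergence,
  in which the cofactors multiply the derivatives of the physical flux, is paired with the cofactor
  entries themselves; this is possible because the projection reproduces them. The volume term that
  remains contains the divergence of the rows of the cofactor matrix and vanishes by the geometric
  conservation law (\<open>geometric_conservation_law\<close>), which is \<open>div curl = 0\<close> for polynomials.

  The two facet sums are those of the projected reference flux and of the projected physical flux
  transformed by the cofactors. The correction flux subtracts half of each, so only the numerical flux
  survives (\<open>element_balance\<close>). Summed over a periodic mesh, the numerical fluxes from the two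
  sides of each interface are opposite (\<open>interface_cancellation\<close>).
\<close>

section \<open>Partial derivatives of polynomials\<close>

lemma tensor_poly_polynomial: "g \<in> tensor_poly d \<Longrightarrow> real_polynomial_function g"
  using real_polynomial_function.intros(1)[OF bounded_linear_vec_nth]
  unfolding tensor_poly_def
  by (auto intro!: real_polynomial_function_sum real_polynomial_function.intros(2,4)
    real_polynomial_function_power)

lemma polynomial_DERIV:
  assumes "real_polynomial_function g"
  shows "((\<lambda>h. g (\<xi> + h *\<^sub>R axis j 1)) has_real_derivative partial_deriv j g \<xi>) (at 0)"
proof -
  have "g differentiable at (\<xi> + 0 *\<^sub>R axis j 1)"
    using assms by (rule differentiable_at_real_polynomial_function)
  then have "(g \<circ> (\<lambda>h::real. \<xi> + h *\<^sub>R axis j 1)) differentiable at 0"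
    by (intro differentiable_chain_at) (auto intro!: derivative_intros)
  then show ?thesis
    unfolding partial_deriv_def comp_def
    by (simp add: DERIV_deriv_iff_real_differentiable)
qed

lemma partial_deriv_eqI:
  "((\<lambda>h. g (\<xi> + h *\<^sub>R axis j 1)) has_real_derivative D) (at 0) \<Longrightarrow> partial_deriv j g \<xi> = D"
  unfolding partial_deriv_def by (rule DERIV_imp_deriv)

lemma partial_deriv_const: "partial_deriv j (\<lambda>\<eta>. c) = (\<lambda>\<xi>. 0)"
  by (intro ext partial_deriv_eqI) simp

lemma partial_deriv_linear:
  assumes "bounded_linear g" shows "partial_deriv j g = (\<lambda>\<xi>. g (axis j 1))"
proof (intro ext partial_deriv_eqI)
  interpret bounded_linear g by fact
  show "((\<lambda>h. g (\<xi> + h *\<^sub>R axis j 1)) has_real_derivative g (axis j 1)) (at 0)" for \<xi>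
    by (auto simp: add scaleR intro!: derivative_eq_intros)
qed

lemma partial_deriv_add:
  assumes "real_polynomial_function g" "real_polynomial_function h"
  shows "partial_deriv j (\<lambda>\<eta>. g \<eta> + h \<eta>) = (\<lambda>\<xi>. partial_deriv j g \<xi> + partial_deriv j h \<xi>)"
  by (intro ext partial_deriv_eqI DERIV_add polynomial_DERIV assms)

lemma partial_deriv_diff:
  assumes "real_polynomial_function g" "real_polynomial_function h"
  shows "partial_deriv j (\<lambda>\<eta>. g \<eta> - h \<eta>) = (\<lambda>\<xi>. partial_deriv j g \<xi> - partial_deriv j h \<xi>)"
  by (intro ext partial_deriv_eqI DERIV_diff polynomial_DERIV assms)

lemma partial_deriv_minus:
  assumes "real_polynomial_function g"
  shows "partial_deriv j (\<lambda>\<eta>. - g \<eta>) = (\<lambda>\<xi>. - partial_deriv j g \<xi>)"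
  by (intro ext partial_deriv_eqI DERIV_minus polynomial_DERIV assms)

lemma partial_deriv_mult:
  assumes "real_polynomial_function g" "real_polynomial_function h"
  shows "partial_deriv j (\<lambda>\<eta>. g \<eta> * h \<eta>) =
    (\<lambda>\<xi>. g \<xi> * partial_deriv j h \<xi> + partial_deriv j g \<xi> * h \<xi>)"
proof (intro ext partial_deriv_eqI)
  show "((\<lambda>t. g (\<xi> + t *\<^sub>R axis j 1) * h (\<xi> + t *\<^sub>R axis j 1)) has_real_derivative
      g \<xi> * partial_deriv j h \<xi> + partial_deriv j g \<xi> * h \<xi>) (at 0)" for \<xi>
    using DERIV_mult[OF polynomial_DERIV[OF assms(1)] polynomial_DERIV[OF assms(2)], of \<xi> j \<xi> j]
    by (simp add: add.commute mult.commute)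
qed

lemma partial_deriv_inner:
  assumes "\<And>b. real_polynomial_function (\<lambda>\<eta>. chi \<eta> $ b)"
  shows "partial_deriv j (\<lambda>\<eta>. chi \<eta> \<bullet> c) \<xi> = (\<Sum>b\<in>UNIV. partial_deriv j (\<lambda>\<eta>. chi \<eta> $ b) \<xi> * c $ b)"
  unfolding inner_vec_def inner_real_def
  by (intro partial_deriv_eqI DERIV_sum DERIV_cmult_right polynomial_DERIV assms)

text \<open>
  The sum and product rules above need differentiability of their arguments, so closure under
  differentiation is what lets them be applied a second time.
\<close>

lemma real_polynomial_function_partial_deriv:
  assumes "real_polynomial_function g"
  shows "real_polynomial_function (partial_deriv j g)"
  using assms
proof induction
  case (linear f)
  then show ?case
    by (simp add: partial_deriv_linear real_polynomial_function.intros)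
next
  case (const c)
  then show ?case by (simp add: partial_deriv_const real_polynomial_function.intros)
next
  case (add f g)
  then show ?case by (simp add: partial_deriv_add real_polynomial_function.intros)
next
  case (mult f g)
  then show ?case
    by (simp add: partial_deriv_mult real_polynomial_function.intros)
qed

text \<open>
  Structural induction on the polynomial replaces an appeal to Schwarz's theorem: in the product case
  the product rule, applied twice, gives an expression that the
  induction hypotheses make symmetric in \<open>i\<close> and \<open>j\<close>.
\<close>

lemma partial_deriv_commute:
  assumes "real_polynomial_function g"
  shows "partial_deriv i (partial_deriv j g) = partial_deriv j (partial_deriv i g)"
  using assms
proof induction
  case (linear f)
  then show ?case by (simp add: partial_deriv_linear partial_deriv_const)
next
  case (const c)
  then show ?case by (simp add: partial_deriv_const)
next
  case (add f g)
  then show ?case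
    by (simp add: partial_deriv_add real_polynomial_function_partial_deriv)
next
  case (mult f g)
  then show ?case
    by (simp add: partial_deriv_mult partial_deriv_add algebra_simps
      real_polynomial_function_partial_deriv real_polynomial_function.intros)
qed

section \<open>The geometric conservation law\<close>

lemma curl_components:
  "curl V \<xi> $ 1 = partial_deriv 2 (\<lambda>\<eta>. V \<eta> $ 3) \<xi> - partial_deriv 3 (\<lambda>\<eta>. V \<eta> $ 2) \<xi>"
  "curl V \<xi> $ 2 = partial_deriv 3 (\<lambda>\<eta>. V \<eta> $ 1) \<xi> - partial_deriv 1 (\<lambda>\<eta>. V \<eta> $ 3) \<xi>"
  "curl V \<xi> $ 3 = partial_deriv 1 (\<lambda>\<eta>. V \<eta> $ 2) \<xi> - partial_deriv 2 (\<lambda>\<eta>. V \<eta> $ 1) \<xi>"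
proof -
  have idx: "(1::3) + 1 = 2" "(1::3) + 2 = 3" "(2::3) + 1 = 3" "(2::3) + 2 = 1"
    "(3::3) + 1 = 1" "(3::3) + 2 = 2" by simp_all
  show "curl V \<xi> $ 1 = partial_deriv 2 (\<lambda>\<eta>. V \<eta> $ 3) \<xi> - partial_deriv 3 (\<lambda>\<eta>. V \<eta> $ 2) \<xi>"
    "curl V \<xi> $ 2 = partial_deriv 3 (\<lambda>\<eta>. V \<eta> $ 1) \<xi> - partial_deriv 1 (\<lambda>\<eta>. V \<eta> $ 3) \<xi>"
    "curl V \<xi> $ 3 = partial_deriv 1 (\<lambda>\<eta>. V \<eta> $ 2) \<xi> - partial_deriv 2 (\<lambda>\<eta>. V \<eta> $ 1) \<xi>"
    unfolding curl_def vec_lambda_beta idx by (rule refl)+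
qed

lemma divergence_curl:
  assumes V: "\<And>i. real_polynomial_function (\<lambda>\<eta>. V \<eta> $ i)"
  shows "(\<Sum>i\<in>UNIV. partial_deriv i (\<lambda>\<eta>. curl V \<eta> $ i) \<xi>) = 0"
  by (simp add: sum_3 curl_components partial_deriv_diff real_polynomial_function_partial_deriv V
      partial_deriv_commute[OF V, of 1 2] partial_deriv_commute[OF V, of 1 3]
      partial_deriv_commute[OF V, of 2 3])

lemma interpolant_polynomial:
  assumes "unisolvent r z" shows "real_polynomial_function (interpolant r z h)"
proof -
  have "\<exists>!g. g \<in> tensor_poly r \<and> (\<forall>a. g (z a) = h (z a))"
    using assms unfolding unisolvent_def by (rule allE[where x = "\<lambda>a. h (z a)"])
  from theI'[OF this] show ?thesis
    unfolding interpolant_def by (blast intro: tensor_poly_polynomial)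
qed

lemma curl_polynomial:
  assumes "\<And>i. real_polynomial_function (\<lambda>\<eta>. V \<eta> $ i)"
  shows "real_polynomial_function (\<lambda>\<eta>. curl V \<eta> $ i)"
  unfolding curl_def
  by (simp add: real_polynomial_function_diff real_polynomial_function_partial_deriv assms)

text \<open>
  Interpolation does not commute with the curl, so the computed cofactors may differ from the exact ones.
  Being minus the curl of an interpolated field, each row is nevertheless divergence free, because the
  interpolant is itself a polynomial.
\<close>

lemma geometric_conservation_law:
  assumes "unisolvent r z"
  shows "(\<Sum>j\<in>UNIV. partial_deriv j (\<lambda>\<eta>. metric_cofactor form r z \<Theta> \<eta> $ n $ j) \<xi>) = 0"
proof -
  let ?V = "vec_interpolant r z (curl_potential form \<Theta> n)"
  have V: "real_polynomial_function (\<lambda>\<eta>. ?V \<eta> $ i)" for i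
    unfolding vec_interpolant_def by (simp add: interpolant_polynomial assms)
  have "(\<Sum>j\<in>UNIV. partial_deriv j (\<lambda>\<eta>. metric_cofactor form r z \<Theta> \<eta> $ n $ j) \<xi>) =
      - (\<Sum>j\<in>UNIV. partial_deriv j (\<lambda>\<eta>. curl ?V \<eta> $ j) \<xi>)"
    by (simp add: metric_cofactor_def partial_deriv_minus curl_polynomial V sum_negf)
  then show ?thesis
    using divergence_curl[of ?V, OF V] by simp
qed

section \<open>Summation by parts\<close>

lemma pderiv_matrix_mult:
  assumes "\<And>b. real_polynomial_function (\<lambda>\<eta>. chi \<eta> $ b)"
  shows "(pderiv_matrix j chi xv *v c) $ q = partial_deriv j (\<lambda>\<eta>. chi \<eta> \<bullet> c) (xv q)"
  by (simp add: partial_deriv_inner assms pderiv_matrix_def matrix_vector_mult_def)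

lemma diag_matrix_mult: "(diag_matrix w *v y) $ q = w $ q * y $ q"
  by (simp add: diag_matrix_def matrix_vector_mult_def if_distrib if_distribR cong: if_cong)

lemma basis_matrix_mult: "(basis_matrix chi xv *v c) $ q = chi (xv q) \<bullet> c"
  by (simp add: basis_matrix_def matrix_vector_mul_component)

lemma inner_transpose_mult:
  fixes A :: "real^'n::finite^'m::finite"
  shows "x \<bullet> (transpose A *v y) = (A *v x) \<bullet> y"
  by (metis dot_lmul_matrix inner_commute transpose_matrix_vector)

lemma inner_weighted_test:
  "a \<bullet> ((transpose (basis_matrix chi xv) ** diag_matrix w) *v y) =
    (\<Sum>q\<in>UNIV. w $ q * (chi (xv q) \<bullet> a) * y $ q)"
proof -
  have "a \<bullet> ((transpose (basis_matrix chi xv) ** diag_matrix w) *v y) =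
      (basis_matrix chi xv *v a) \<bullet> (diag_matrix w *v y)"
    by (simp only: inner_transpose_mult flip: matrix_vector_mul_assoc)
  also have "\<dots> = (\<Sum>q\<in>UNIV. w $ q * (chi (xv q) \<bullet> a) * y $ q)"
    by (simp add: inner_vec_def[of "_ *v a"] diag_matrix_mult basis_matrix_mult ac_simps)
  finally show ?thesis .
qed

text \<open>
  The matrix identity defining discrete integration by parts, tested with two coefficient vectors and
  read as a product rule for the polynomials they represent. In this form the choices of \<open>a\<close> and \<open>c\<close>
  below cost no matrix manipulation.
\<close>

lemma summation_by_parts:
  assumes chi: "\<And>b. real_polynomial_function (\<lambda>\<eta>. chi \<eta> $ b)"
    and ibp: "discrete_ibp chi xv w xf fw"
  shows "(\<Sum>q\<in>UNIV. w $ q * (chi (xv q) \<bullet> a) * partial_deriv j (\<lambda>\<eta>. chi \<eta> \<bullet> c) (xv q)) +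
      (\<Sum>q\<in>UNIV. w $ q * (chi (xv q) \<bullet> c) * partial_deriv j (\<lambda>\<eta>. chi \<eta> \<bullet> a) (xv q)) =
      (\<Sum>F\<in>UNIV. \<Sum>k\<in>UNIV. fw F k * ref_normal F $ j * (chi (xf F k) \<bullet> a) * (chi (xf F k) \<bullet> c))"
proof -
  let ?S = "stiffness_matrix j chi xv w"
  have S: "a \<bullet> (?S *v c) =
      (\<Sum>q\<in>UNIV. w $ q * (chi (xv q) \<bullet> a) * partial_deriv j (\<lambda>\<eta>. chi \<eta> \<bullet> c) (xv q))" for a c
    unfolding stiffness_matrix_def
    by (subst matrix_vector_mul_assoc[symmetric]) (simp add: inner_weighted_test pderiv_matrix_mult chi)
  have rank1: "a \<bullet> ((\<chi> i l. v $ i * s * n * v $ l) *v c) = s * n * (v \<bullet> a) * (v \<bullet> c)"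
    for v :: "real^'a" and s n
    by (simp add: inner_vec_def matrix_vector_mult_def sum_distrib_left sum_distrib_right ac_simps)
  have sum_mv: "(\<Sum>i\<in>I. A i) *v c = (\<Sum>i\<in>I. A i *v c)" for A :: "'i \<Rightarrow> real^'a^'a" and I
    by (induction I rule: infinite_finite_induct) (auto simp: matrix_vector_mult_add_rdistrib)
  have "a \<bullet> (?S *v c) + c \<bullet> (?S *v a) = a \<bullet> ((?S + transpose ?S) *v c)"
    by (simp only: matrix_vector_mult_add_rdistrib inner_add_right inner_transpose_mult inner_commute)
  also have "\<dots> = (\<Sum>F\<in>UNIV. \<Sum>k\<in>UNIV.
      fw F k * ref_normal F $ j * (chi (xf F k) \<bullet> a) * (chi (xf F k) \<bullet> c))"
    using ibp unfolding discrete_ibp_def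
    by (simp add: sum_mv inner_sum_right rank1)
  finally show ?thesis unfolding S .
qed

text \<open>
  The hypothesis on \<open>one\<close> concerns the volume nodes only, whereas the facet terms need the value at
  the facet nodes. The true coefficients \<open>e\<close> of the constant have the same values at the volume nodes,
  and an invertible mass matrix allows no two coefficient vectors with this property.
\<close>

lemma constant_coefficients:
  assumes "tensor_basis p chi" "invertible (mass_matrix chi xv w)" "basis_matrix chi xv *v one = 1"
  shows "chi \<xi> \<bullet> one = 1"
proof -
  have "(\<lambda>\<xi>. 1) \<in> tensor_poly p"
  proof -
    have pull: "(\<Sum>k\<in>A. if b then g k else 0) = (if b then sum g A else 0)"
      for A :: "nat set" and b and g :: "nat \<Rightarrow> real" by simp
    have "(\<Sum>i\<le>p. \<Sum>j\<le>p. \<Sum>k\<le>p. (if i = 0 then if j = 0 then if k = 0 then 1 else 0 else 0 else 0) *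
        (\<xi>$1)^i * (\<xi>$2)^j * (\<xi>$3)^k) = 1" for \<xi> :: "real^3"
      by (simp add: if_distribR if_distrib[of "\<lambda>x. x * _"] pull cong: if_cong)
    then show ?thesis unfolding tensor_poly_def mem_Collect_eq fun_eq_iff
      by (intro exI[of _ "\<lambda>i j k. if i = 0 then if j = 0 then if k = 0 then 1 else 0 else 0 else 0"]) simp
  qed
  then obtain e where e: "\<And>\<xi>. chi \<xi> \<bullet> e = 1"
    using assms(1) unfolding tensor_basis_def by (metis (no_types, lifting))
  have "basis_matrix chi xv *v e = 1"
    by (simp add: vec_eq_iff basis_matrix_mult e)
  then have "mass_matrix chi xv w *v e = mass_matrix chi xv w *v one"
    unfolding mass_matrix_def by (simp add: assms(3) flip: matrix_vector_mul_assoc)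
  then have "e = one"
    using assms(2) by (metis inj_matrix_vector_mult injD)
  then show ?thesis using e by simp
qed

section \<open>Conservation\<close>

text \<open>
  Half of the discrete divergence is written in terms of the reference flux and half in terms of the
  physical flux. After testing with the constant, each half becomes a facet sum: the first because the
  constant has zero derivative, the second because the rows of \<open>C\<close> are reproduced by the projection
  and are divergence free. The factor one half in front of
  the two is matched by the halves that the correction flux subtracts, and both sums cancel.
\<close>

lemma element_balance:
  assumes chi: "\<And>b. real_polynomial_function (\<lambda>\<eta>. chi \<eta> $ b)"
    and ibp: "discrete_ibp chi xv w xf fw"
    and gcl: "\<And>n \<xi>. (\<Sum>j\<in>UNIV. partial_deriv j (\<lambda>\<eta>. C \<eta> $ n $ j) \<xi>) = 0"
    and repro: "\<And>n i \<xi>. chi \<xi> \<bullet> (L2_projection chi xv w *v (\<chi> q. C (xv q) $ n $ i)) = C \<xi> $ n $ i"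
    and one: "\<And>\<xi>. chi \<xi> \<bullet> one = 1"
    and scheme: "scheme_eq p c chi xv w xf fw f \<Theta> C fs u du"
  shows "one \<bullet> (elem_norm p c chi xv w \<Theta> *v du) =
    - (\<Sum>F\<in>UNIV. \<Sum>k\<in>UNIV. fw F k * ((ref_normal F v* transpose (C (xf F k))) \<bullet> fs F k))"
proof -
  define R where "R = ref_flux_coeff chi xv w f C u"
  define P where "P = phys_flux_coeff chi xv w f u"
  define cC where "cC = (\<lambda>n i. L2_projection chi xv w *v (\<chi> q. C (xv q) $ n $ i))"
  have C: "chi \<xi> \<bullet> cC n i = C \<xi> $ n $ i" for \<xi> n i
    unfolding cC_def by (rule repro)
  have ref: "(\<Sum>q\<in>UNIV. w $ q * ref_flux_div chi xv w f C u $ q) =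
      (\<Sum>F\<in>UNIV. \<Sum>k\<in>UNIV. fw F k * (ref_normal F \<bullet> (\<chi> j. chi (xf F k) \<bullet> R j)))"
  proof -
    have "(\<Sum>q\<in>UNIV. w $ q * partial_deriv j (\<lambda>\<eta>. chi \<eta> \<bullet> R j) (xv q)) =
      (\<Sum>F\<in>UNIV. \<Sum>k\<in>UNIV. fw F k * ref_normal F $ j * (chi (xf F k) \<bullet> R j))" for j
      using summation_by_parts[OF chi ibp, where a = one and c = "R j" and j = j]
      by (simp add: one partial_deriv_const)
    then have "(\<Sum>j\<in>UNIV. \<Sum>q\<in>UNIV. w $ q * partial_deriv j (\<lambda>\<eta>. chi \<eta> \<bullet> R j) (xv q)) =
      (\<Sum>j\<in>UNIV. \<Sum>F\<in>UNIV. \<Sum>k\<in>UNIV. fw F k * ref_normal F $ j * (chi (xf F k) \<bullet> R j))"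
      by simp
    then show ?thesis
      unfolding ref_flux_div_def R_def[symmetric]
      by (simp add: pderiv_matrix_mult chi sum_3 sum.distrib inner_vec_def algebra_simps)
  qed
  have phys: "(\<Sum>q\<in>UNIV. w $ q * phys_flux_div chi xv w f C u $ q) =
      (\<Sum>F\<in>UNIV. \<Sum>k\<in>UNIV. fw F k * (ref_normal F \<bullet> ((\<chi> i. chi (xf F k) \<bullet> P i) v* C (xf F k))))"
  proof -
    \<comment> \<open>The test functions are now the cofactor entries, written in the basis through \<open>cC\<close>.\<close>
    have *: "(\<Sum>q\<in>UNIV. w $ q * C (xv q) $ i $ j * partial_deriv j (\<lambda>\<eta>. chi \<eta> \<bullet> P i) (xv q)) +
      (\<Sum>q\<in>UNIV. w $ q * (chi (xv q) \<bullet> P i) * partial_deriv j (\<lambda>\<eta>. C \<eta> $ i $ j) (xv q)) =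
      (\<Sum>F\<in>UNIV. \<Sum>k\<in>UNIV. fw F k * ref_normal F $ j * C (xf F k) $ i $ j * (chi (xf F k) \<bullet> P i))" for i j
      using summation_by_parts[OF chi ibp, where a = "cC i j" and c = "P i" and j = j]
      by (simp add: C)
    have "(\<Sum>j\<in>UNIV. \<Sum>q\<in>UNIV. w $ q * (chi (xv q) \<bullet> P i) * partial_deriv j (\<lambda>\<eta>. C \<eta> $ i $ j) (xv q)) = 0" for i
      by (subst sum.swap) (simp add: gcl flip: sum_distrib_left)
    then have "(\<Sum>i\<in>UNIV. \<Sum>j\<in>UNIV. \<Sum>q\<in>UNIV. w $ q * C (xv q) $ i $ j * partial_deriv j (\<lambda>\<eta>. chi \<eta> \<bullet> P i) (xv q)) =
      (\<Sum>i\<in>UNIV. \<Sum>j\<in>UNIV. \<Sum>F\<in>UNIV. \<Sum>k\<in>UNIV. fw F k * ref_normal F $ j * C (xf F k) $ i $ j * (chi (xf F k) \<bullet> P i))"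
      by (simp add: sum.distrib flip: *)
    then show ?thesis
      unfolding phys_flux_div_def P_def[symmetric]
      by (simp add: pderiv_matrix_mult diag_matrix_mult chi sum_3 sum.distrib inner_vec_def
        vector_matrix_mult_def algebra_simps)
  qed
  have num: "ref_normal F \<bullet> (fs F k v* C (xf F k)) = (ref_normal F v* transpose (C (xf F k))) \<bullet> fs F k" for F k
    by (metis dot_lmul_matrix inner_commute vector_transpose_matrix)
  have "0 = one \<bullet> (elem_norm p c chi xv w \<Theta> *v du)
     + (1/2) * (\<Sum>q\<in>UNIV. w $ q * (ref_flux_div chi xv w f C u + phys_flux_div chi xv w f C u) $ q)
     + (\<Sum>F\<in>UNIV. \<Sum>k\<in>UNIV. fw F k * (ref_normal F \<bullet> corr_flux chi xv w f C u (xf F k) (fs F k)))"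
    using arg_cong[OF scheme[unfolded scheme_eq_def], of "inner one"]
    by (simp only: inner_add_right inner_scaleR_right inner_sum_right inner_weighted_test one
        inner_commute[of one "chi _"] mult_1_right inner_zero_right)
  also have "(\<Sum>F\<in>UNIV. \<Sum>k\<in>UNIV. fw F k * (ref_normal F \<bullet> corr_flux chi xv w f C u (xf F k) (fs F k))) =
      (\<Sum>F\<in>UNIV. \<Sum>k\<in>UNIV. fw F k * ((ref_normal F v* transpose (C (xf F k))) \<bullet> fs F k))
      - (1/2) * (\<Sum>F\<in>UNIV. \<Sum>k\<in>UNIV. fw F k * (ref_normal F \<bullet> ((\<chi> i. chi (xf F k) \<bullet> P i) v* C (xf F k))))
      - (1/2) * (\<Sum>F\<in>UNIV. \<Sum>k\<in>UNIV. fw F k * (ref_normal F \<bullet> (\<chi> j. chi (xf F k) \<bullet> R j)))"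
    unfolding corr_flux_def P_def[symmetric] R_def[symmetric]
    by (simp add: inner_diff_right num right_diff_distrib sum_subtractf sum_distrib_left ac_simps)
  finally show ?thesis
    by (simp add: distrib_left sum.distrib ref phys)
qed

text \<open>
  On a periodic mesh, passing to the same facet node seen from the other element is an involution of all
  triples (element, face, node) that reverses the sign of each summand, so the sum equals its negative.
\<close>

lemma interface_cancellation:
  fixes \<Theta> :: "'m::finite \<Rightarrow> real^3 \<Rightarrow> real^3"
  assumes mesh: "conforming_mesh \<Omega> xf fw \<Theta> C nbr mate shift" and per: "periodic_mesh nbr"
    and sv: "single_valued_flux nbr mate fs"
  shows "(\<Sum>m\<in>UNIV. \<Sum>F\<in>UNIV. \<Sum>k\<in>UNIV.
      fw F k * ((ref_normal F v* transpose (C m (xf F k))) \<bullet> fs m F k)) = 0"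
proof -
  define flux where "flux = (\<lambda>(m, F, k). fw F k * ((ref_normal F v* transpose (C m (xf F k))) \<bullet> fs m F k))"
  define opp where "opp = (\<lambda>(m, F, k). (fst (the (nbr (m, F))), snd (the (nbr (m, F))), mate (m, F) k))"
  have opp: "opp (opp x) = x" "flux (opp x) = - flux x" for x
  proof -
    obtain m F k where x: "x = (m, F, k)" by (cases x)
    obtain m' F' where n: "nbr (m, F) = Some (m', F')"
      using per unfolding periodic_mesh_def by (metis not_None_eq surj_pair)
    note glued = mesh[unfolded conforming_mesh_def, THEN conjunct2, rule_format, OF n]
    have n': "nbr (m', F') = Some (m, F)" and mm: "mate (m', F') (mate (m, F) k) = k"
      and fw: "fw F k = fw F' (mate (m, F) k)"
      and nC: "ref_normal F v* transpose (C m (xf F k)) =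
               - (ref_normal F' v* transpose (C m' (xf F' (mate (m, F) k))))"
      by (simp_all only: glued)
    have "fs m F k = fs m' F' (mate (m, F) k)"
      using sv n unfolding single_valued_flux_def by blast
    then show "opp (opp x) = x" "flux (opp x) = - flux x"
      by (simp_all add: x opp_def flux_def n n' mm fw nC del: vector_transpose_matrix)
  qed
  have "bij opp"
    using opp(1) by (metis bij_iff)
  then have "sum flux UNIV = (\<Sum>x\<in>UNIV. flux (opp x))"
    by (rule sum.reindex_bij_betw[symmetric])
  then have "sum flux UNIV = 0"
    by (simp add: opp(2) sum_negf)
  then show ?thesis
    by (simp add: flux_def sum.cartesian_product split_def)
qed

theorem mainTheorem2:
  fixes p r :: nat
    and chi :: "real^3 \<Rightarrow> real^'b::finite"
    and xv :: "'q::finite \<Rightarrow> real^3" and w :: "real^'q"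
    and xf :: "face \<Rightarrow> 'k::finite \<Rightarrow> real^3" and fw :: "face \<Rightarrow> 'k \<Rightarrow> real"
    and z :: "'g::finite \<Rightarrow> real^3"
    and form :: curl_form
    and \<Omega> :: "(real^3) set"
    and \<Theta> :: "'m::finite \<Rightarrow> real^3 \<Rightarrow> real^3"
    and C :: "'m \<Rightarrow> real^3 \<Rightarrow> real^3^3"
    and nbr :: "'m \<times> face \<Rightarrow> ('m \<times> face) option"
    and mate :: "'m \<times> face \<Rightarrow> 'k \<Rightarrow> 'k"
    and shift :: "'m \<times> face \<Rightarrow> real^3"
    and c1D :: real
    and f :: "real \<Rightarrow> real^3"
    and T :: "real set"
    and u :: "'m \<Rightarrow> real \<Rightarrow> real^'b"
    and fstar :: "real \<Rightarrow> 'm \<Rightarrow> face \<Rightarrow> 'k \<Rightarrow> real^3"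
    and one :: "real^'b"
  assumes "p \<ge> 1" and "tensor_basis p chi"
    and "\<And>q. xv q \<in> ref_cube" and "\<And>F k. xf F k \<in> ref_face F"
    and "\<And>F k. fw F k > 0"
    and "volume_exact (2 * p - 1) xv w" and "facet_exact (2 * p - 1) xf fw"
    and "discrete_ibp chi xv w xf fw"
    and "invertible (mass_matrix chi xv w)"
    and "\<And>a. z a \<in> ref_cube" and "unisolvent r z"
    and "\<And>m i. (\<lambda>\<xi>. \<Theta> m \<xi> $ i) \<in> tensor_poly r"
    and "\<And>m \<xi>. \<xi> \<in> ref_cube \<Longrightarrow> det (jacobian (\<Theta> m) (at \<xi>)) > 0"
    and "partition_of_domain \<Omega> \<Theta>"
    and "\<And>m. C m = metric_cofactor form r z (\<Theta> m)"
    and "\<And>m n i \<xi>. chi \<xi> \<bullet> (L2_projection chi xv w *v (\<chi> q. C m (xv q) $ n $ i)) = C m \<xi> $ n $ i"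
    and "\<And>m. sym_pos_def (elem_norm p c1D chi xv w (\<Theta> m))"
    and "conforming_mesh \<Omega> xf fw \<Theta> C nbr mate shift"
    and "is_interval T" and "interior T \<noteq> {}"
    and "\<And>m t. t \<in> T \<Longrightarrow> u m differentiable (at t within T)"
    and "\<And>t. t \<in> T \<Longrightarrow> single_valued_flux nbr mate (fstar t)"
    and "\<And>m t. t \<in> T \<Longrightarrow>
           scheme_eq p c1D chi xv w xf fw f (\<Theta> m) (C m) (fstar t m)
             (u m t) (vector_derivative (u m) (at t within T))"
    and "basis_matrix chi xv *v one = 1"
  shows "(\<forall>t\<in>T. \<forall>m.
            one \<bullet> (elem_norm p c1D chi xv w (\<Theta> m) *v vector_derivative (u m) (at t within T)) =
            - (\<Sum>F\<in>UNIV. \<Sum>k\<in>UNIV.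
                 fw F k * ((ref_normal F v* transpose (C m (xf F k))) \<bullet> fstar t m F k)))
       \<and> (periodic_mesh nbr \<longrightarrow>
           (\<forall>t\<in>T. (\<Sum>m\<in>UNIV.
              one \<bullet> (elem_norm p c1D chi xv w (\<Theta> m) *v vector_derivative (u m) (at t within T))) = 0))"
proof -
  have chi: "\<And>b. real_polynomial_function (\<lambda>\<eta>. chi \<eta> $ b)"
    using \<open>tensor_basis p chi\<close> unfolding tensor_basis_def by (blast intro: tensor_poly_polynomial)
  have gcl: "(\<Sum>j\<in>UNIV. partial_deriv j (\<lambda>\<eta>. C m \<eta> $ n $ j) \<xi>) = 0" for m n \<xi>
    using geometric_conservation_law[OF \<open>unisolvent r z\<close>] by (simp add: assms(15))
  have one: "chi \<xi> \<bullet> one = 1" for \<xi>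
    using assms(2,9,24) by (rule constant_coefficients)
  have local: "one \<bullet> (elem_norm p c1D chi xv w (\<Theta> m) *v vector_derivative (u m) (at t within T)) =
      - (\<Sum>F\<in>UNIV. \<Sum>k\<in>UNIV.
          fw F k * ((ref_normal F v* transpose (C m (xf F k))) \<bullet> fstar t m F k))"
    if "t \<in> T" for t m
    using chi \<open>discrete_ibp chi xv w xf fw\<close> gcl assms(16) one assms(23)[OF that]
    by (rule element_balance)
  have "(\<Sum>m\<in>UNIV. one \<bullet> (elem_norm p c1D chi xv w (\<Theta> m) *v
      vector_derivative (u m) (at t within T))) = 0"
    if "periodic_mesh nbr" "t \<in> T" for t
    using interface_cancellation[OF assms(18) that(1) assms(22)[OF that(2)]]
    by (simp add: local that(2) sum_negf)
  then show ?thesis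
    using local by blast
qed

end
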